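(* Let $n\ge 1$, and let $\mathcal R_{2n+3}=\{R_i\mid -(n+1)\le i\le n+1\}$ with the relations $R_i$ as defined in the context. Then the algebra $\mathbb S_{2n+3}=\langle \mathcal R_{2n+3},\cap,\cup,\circ,\Rightarrow,R_0,{\sim}\rangle$ is an odd Sugihara chain, and $\mathbf S_{2n+3}\cong\mathbb S_{2n+3}$.
   Context: Fix $n\ge1$. For $p=(p_1,\dots,p_n)\in\mathbb Q^n$ define relations on $\mathbb Q^n$: $(p,q)\in L_1$ iff $p_1<q_1$; for $2\le i\le n$, $(p,q)\in L_i$ iff $(p_1,\dots,p_{i-1})=(q_1,\dots,q_{i-1})$ and $p_i<q_i$. Let $<_n$ be $L_1\cup\dots\cup L_n$ (strict lexicographic order). Let $X=\mathbb Q^n\times\{-1,1\}$, writing $p^b$ for $(p,b)$, with $p^b\le_X q^d$ iff $p^b=q^d$ or $p<_n q$. Let $\alpha:X\to X$, $\alpha(p^b)=p^{-b}$. For $R\subseteq X^2$, $R^c=X^2\setminus R$, $R^\smile$ is the converse, and $\circ$ is relational composition. For $1\le j\le n$ let $U_j=\{(p^b,q^d)\mid b,d\in\{-1,1\},(p,q)\in L_j\}$. Define $R_{-n-1}=\varnothing$; $R_i=\bigcup_{j=1}^{n+1+i}U_j$ for $-n\le i\le -1$; $R_0={\le_X}$; $R_i=(R_{-i})^{c\smile}\circ\alpha$ for $1\le i\le n+1$. Operations: ${\sim}R=R^{c\smile}\circ\alpha$, $-R=\alpha\circ R^{c\smile}$, and $R\Rightarrow S={\sim}(-S\circ R)$ (equivalently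 $(R^\smile\circ S^c)^c$). The abstract odd Sugihara chain $\mathbf S_{2k+1}$ ($k\ge1$) has universe $\{a_{-k},\dots,a_0,\dots,a_k\}$, $a_i\wedge a_j=a_{\min\{i,j\}}$, $a_i\vee a_j=a_{\max\{i,j\}}$, ${\sim}a_j=a_{-j}$, $a_i\cdot a_j=a_i$ if $|j|<|i|$, $=a_j$ if $|i|<|j|$, $=a_{\min\{i,j\}}$ if $|i|=|j|$; $a_i\to a_j={\sim}a_i\vee a_j$ if $i\le j$ and ${\sim}a_i\wedge a_j$ if $i>j$; identity $1=a_0$. A Sugihara chain is a linearly ordered Sugihara monoid; it is odd if ${\sim}1=1$. *)

theory Defs
  imports Complex_Main "HOL-Algebra.Group"
begin

section \<open>Sugihara monoids\<close>

record 'a residuated_algebra = "'a monoid" +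
  lmeet :: "'a \<Rightarrow> 'a \<Rightarrow> 'a" (infixl "\<curlywedge>\<index>" 70)
  ljoin :: "'a \<Rightarrow> 'a \<Rightarrow> 'a" (infixl "\<curlyvee>\<index>" 65)
  limp :: "'a \<Rightarrow> 'a \<Rightarrow> 'a" (infixr "\<leadsto>\<index>" 60)
  lneg :: "'a \<Rightarrow> 'a" ("\<sim>\<index>_" [81] 80)

definition alg_le :: "('a, 'm) residuated_algebra_scheme \<Rightarrow> 'a \<Rightarrow> 'a \<Rightarrow> bool" (infix "\<preceq>\<index>" 50)
  where "x \<preceq>\<^bsub>A\<^esub> y \<longleftrightarrow> x \<curlywedge>\<^bsub>A\<^esub> y = x"

text \<open>
  A Sugihara monoid is a commutative, distributive, idempotent, involutive residuated lattice;
  involutivity is \<open>\<sim>\<sim>x = x\<close> together with contraposition.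
\<close>

locale sugihara_monoid = comm_monoid A
  for A :: "('a, 'm) residuated_algebra_scheme" (structure) +
  assumes meet_closed: "\<lbrakk>x \<in> carrier A; y \<in> carrier A\<rbrakk> \<Longrightarrow> x \<curlywedge> y \<in> carrier A"
    and join_closed: "\<lbrakk>x \<in> carrier A; y \<in> carrier A\<rbrakk> \<Longrightarrow> x \<curlyvee> y \<in> carrier A"
    and imp_closed: "\<lbrakk>x \<in> carrier A; y \<in> carrier A\<rbrakk> \<Longrightarrow> (x \<leadsto> y) \<in> carrier A"
    and neg_closed: "x \<in> carrier A \<Longrightarrow> \<sim>x \<in> carrier A"
    and meet_assoc: "\<lbrakk>x \<in> carrier A; y \<in> carrier A; z \<in> carrier A\<rbrakk>
      \<Longrightarrow> (x \<curlywedge> y) \<curlywedge> z = x \<curlywedge> (y \<curlywedge> z)"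
    and join_assoc: "\<lbrakk>x \<in> carrier A; y \<in> carrier A; z \<in> carrier A\<rbrakk>
      \<Longrightarrow> (x \<curlyvee> y) \<curlyvee> z = x \<curlyvee> (y \<curlyvee> z)"
    and meet_comm: "\<lbrakk>x \<in> carrier A; y \<in> carrier A\<rbrakk> \<Longrightarrow> x \<curlywedge> y = y \<curlywedge> x"
    and join_comm: "\<lbrakk>x \<in> carrier A; y \<in> carrier A\<rbrakk> \<Longrightarrow> x \<curlyvee> y = y \<curlyvee> x"
    and meet_join_absorb: "\<lbrakk>x \<in> carrier A; y \<in> carrier A\<rbrakk> \<Longrightarrow> x \<curlywedge> (x \<curlyvee> y) = x"
    and join_meet_absorb: "\<lbrakk>x \<in> carrier A; y \<in> carrier A\<rbrakk> \<Longrightarrow> x \<curlyvee> (x \<curlywedge> y) = x"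
    and meet_join_distrib: "\<lbrakk>x \<in> carrier A; y \<in> carrier A; z \<in> carrier A\<rbrakk>
      \<Longrightarrow> x \<curlywedge> (y \<curlyvee> z) = (x \<curlywedge> y) \<curlyvee> (x \<curlywedge> z)"
    and mult_idem: "x \<in> carrier A \<Longrightarrow> x \<otimes> x = x"
    and residuation: "\<lbrakk>x \<in> carrier A; y \<in> carrier A; z \<in> carrier A\<rbrakk>
      \<Longrightarrow> x \<otimes> y \<preceq> z \<longleftrightarrow> y \<preceq> (x \<leadsto> z)"
    and neg_neg: "x \<in> carrier A \<Longrightarrow> \<sim>(\<sim>x) = x"
    and contraposition: "\<lbrakk>x \<in> carrier A; y \<in> carrier A\<rbrakk> \<Longrightarrow> (x \<leadsto> \<sim>y) = (y \<leadsto> \<sim>x)"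

locale sugihara_chain = sugihara_monoid +
  assumes linear: "\<lbrakk>x \<in> carrier A; y \<in> carrier A\<rbrakk> \<Longrightarrow> x \<preceq> y \<or> y \<preceq> x"

locale odd_sugihara_chain = sugihara_chain +
  assumes odd: "\<sim>\<one> = \<one>"

text \<open>
  The library's \<open>iso\<close> only provides a bijection of the carriers that preserves \<open>\<otimes>\<close>; the remaining
  operations are added here.
\<close>

definition algebra_iso ::
  "('a, 'm) residuated_algebra_scheme \<Rightarrow> ('b, 'k) residuated_algebra_scheme \<Rightarrow> ('a \<Rightarrow> 'b) set"
  where "algebra_iso A B = {h \<in> iso A B.
    h \<one>\<^bsub>A\<^esub> = \<one>\<^bsub>B\<^esub> \<and>
    (\<forall>x \<in> carrier A. h (\<sim>\<^bsub>A\<^esub>x) = \<sim>\<^bsub>B\<^esub>(h x)) \<and>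
    (\<forall>x \<in> carrier A. \<forall>y \<in> carrier A.
      h (x \<curlywedge>\<^bsub>A\<^esub> y) = h x \<curlywedge>\<^bsub>B\<^esub> h y \<and>
      h (x \<curlyvee>\<^bsub>A\<^esub> y) = h x \<curlyvee>\<^bsub>B\<^esub> h y \<and>
      h (x \<leadsto>\<^bsub>A\<^esub> y) = (h x \<leadsto>\<^bsub>B\<^esub> h y))}"

definition algebra_isomorphic ::
  "('a, 'm) residuated_algebra_scheme \<Rightarrow> ('b, 'k) residuated_algebra_scheme \<Rightarrow> bool"
  where "algebra_isomorphic A B \<longleftrightarrow> algebra_iso A B \<noteq> {}"

section \<open>The abstract odd Sugihara chain with $2k+1$ elements\<close>

text \<open>The element $a_i$ is represented by the integer $i$.\<close>

definition abstract_chain :: "nat \<Rightarrow> int residuated_algebra"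
  where "abstract_chain k = \<lparr>
    carrier = {- int k..int k},
    mult = (\<lambda>i j. if \<bar>j\<bar> < \<bar>i\<bar> then i else if \<bar>i\<bar> < \<bar>j\<bar> then j else min i j),
    one = 0,
    lmeet = min,
    ljoin = max,
    limp = (\<lambda>i j. if i \<le> j then max (- i) j else min (- i) j),
    lneg = uminus\<rparr>"

section \<open>The concrete algebra of relations\<close>

type_synonym point = "(nat \<Rightarrow> rat) \<times> int"

definition Qn :: "nat \<Rightarrow> (nat \<Rightarrow> rat) set"
  where "Qn n = {1..n} \<rightarrow>\<^sub>E UNIV"

definition L :: "nat \<Rightarrow> nat \<Rightarrow> (nat \<Rightarrow> rat) rel"
  where "L n i = {(p, q). p \<in> Qn n \<and> q \<in> Qn n \<and> (\<forall>j \<in> {1..<i}. p j = q j) \<and> p i < q i}"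

definition lex_less :: "nat \<Rightarrow> (nat \<Rightarrow> rat) rel"
  where "lex_less n = (\<Union>i \<in> {1..n}. L n i)"

definition X :: "nat \<Rightarrow> point set"
  where "X n = Qn n \<times> {-1, 1}"

definition leX :: "nat \<Rightarrow> point rel"
  where "leX n = {((p, b), (q, d)). (p, b) \<in> X n \<and> (q, d) \<in> X n \<and>
    ((p, b) = (q, d) \<or> (p, q) \<in> lex_less n)}"

text \<open>The map $\alpha$, as a relation (its graph); \<open>O\<close> composes from left to right.\<close>

definition \<alpha> :: "nat \<Rightarrow> point rel"
  where "\<alpha> n = {((p, b), (p, - b)) | p b. (p, b) \<in> X n}"

definition rcompl :: "nat \<Rightarrow> point rel \<Rightarrow> point rel"
  where "rcompl n R = X n \<times> X n - R"

definition rtilde :: "nat \<Rightarrow> point rel \<Rightarrow> point rel"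
  where "rtilde n R = (rcompl n R)\<inverse> O \<alpha> n"

definition rminus :: "nat \<Rightarrow> point rel \<Rightarrow> point rel"
  where "rminus n R = \<alpha> n O (rcompl n R)\<inverse>"

definition rimp :: "nat \<Rightarrow> point rel \<Rightarrow> point rel \<Rightarrow> point rel"
  where "rimp n R S = rtilde n (rminus n S O R)"

definition U :: "nat \<Rightarrow> nat \<Rightarrow> point rel"
  where "U n j = {((p, b), (q, d)). b \<in> {-1, 1} \<and> d \<in> {-1, 1} \<and> (p, q) \<in> L n j}"

definition Rel_nonpos :: "nat \<Rightarrow> int \<Rightarrow> point rel"
  where "Rel_nonpos n i =
    (if i = - int n - 1 then {}
     else if i = 0 then leX n
     else (\<Union>j \<in> {1..nat (int n + 1 + i)}. U n j))"

text \<open>Only the indices from $-(n+1)$ to $n+1$ are meaningful.\<close>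

definition Rel :: "nat \<Rightarrow> int \<Rightarrow> point rel"
  where "Rel n i =
    (if i \<le> 0 then Rel_nonpos n i else (rcompl n (Rel_nonpos n (- i)))\<inverse> O \<alpha> n)"

definition relation_chain :: "nat \<Rightarrow> point rel residuated_algebra"
  where "relation_chain n = \<lparr>
    carrier = Rel n ` {- (int n + 1)..int n + 1},
    mult = (O),
    one = Rel n 0,
    lmeet = (\<inter>),
    ljoin = (\<union>),
    limp = rimp n,
    lneg = rtilde n\<rparr>"

end

theory Submission imports Defs begin

text \<open>
  Comparing only the first \<open>m\<close> coordinates lexicographically is a strict weak order. The relations
  of negative index are these orders for \<open>m = 0, \<dots>, n\<close>, those of positive index are the
  corresponding total preorders, and \<open>R\<^sub>0\<close> sits in between. Transitivity bounds a composition from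
  above by the coarser factor; density and unboundedness of the rationals, applied to a single
  coordinate, give equality. Hence \<open>i \<mapsto> R\<^sub>i\<close> carries the operations of the abstract chain to those
  of the relation algebra, and the axioms only have to be checked on integers.
\<close>

section \<open>Sugihara chains and isomorphisms\<close>

text \<open>Every element of \<open>carrier B\<close> is an image under \<open>h\<close>, so
  equational axioms pass along the homomorphism. Residuation and linearity speak of the order, and
  \<open>alg_le\<close> is reflected as well as preserved because \<open>h\<close> is
  injective.\<close>

lemma algebra_iso_transfers_odd_sugihara_chain:
  assumes "odd_sugihara_chain A" and h: "h \<in> algebra_iso A B"
  shows "odd_sugihara_chain B"
proof -
  interpret A: odd_sugihara_chain A by fact
  have iso: "h \<in> iso A B" and one: "\<one>\<^bsub>B\<^esub> = h \<one>\<^bsub>A\<^esub>"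
    and neg: "\<And>x. x \<in> carrier A \<Longrightarrow> \<sim>\<^bsub>B\<^esub>(h x) = h (\<sim>\<^bsub>A\<^esub>x)"
    and meet: "\<And>x y. \<lbrakk>x \<in> carrier A; y \<in> carrier A\<rbrakk> \<Longrightarrow> h x \<curlywedge>\<^bsub>B\<^esub> h y = h (x \<curlywedge>\<^bsub>A\<^esub> y)"
    and join: "\<And>x y. \<lbrakk>x \<in> carrier A; y \<in> carrier A\<rbrakk> \<Longrightarrow> h x \<curlyvee>\<^bsub>B\<^esub> h y = h (x \<curlyvee>\<^bsub>A\<^esub> y)"
    and imp: "\<And>x y. \<lbrakk>x \<in> carrier A; y \<in> carrier A\<rbrakk> \<Longrightarrow> (h x \<leadsto>\<^bsub>B\<^esub> h y) = h (x \<leadsto>\<^bsub>A\<^esub> y)"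
    using h by (auto simp: algebra_iso_def)
  have mult: "\<And>x y. \<lbrakk>x \<in> carrier A; y \<in> carrier A\<rbrakk> \<Longrightarrow> h x \<otimes>\<^bsub>B\<^esub> h y = h (x \<otimes>\<^bsub>A\<^esub> y)"
    using iso by (auto simp: iso_def hom_def)
  have carrier: "carrier B = h ` carrier A" and "inj_on h (carrier A)"
    using iso by (auto simp: iso_def bij_betw_def)
  then have inj: "h x = h y \<longleftrightarrow> x = y" if "x \<in> carrier A" "y \<in> carrier A" for x y
    using that by (auto dest: inj_onD)
  note ops = one neg meet join imp mult
    A.meet_closed A.join_closed A.imp_closed A.neg_closed
  have le: "h x \<preceq>\<^bsub>B\<^esub> h y \<longleftrightarrow> x \<preceq>\<^bsub>A\<^esub> y" if "x \<in> carrier A" "y \<in> carrier A" for x y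
    using that by (simp add: alg_le_def ops inj)
  show ?thesis
  proof unfold_locales
    fix x y z
    assume "x \<in> carrier B" "y \<in> carrier B" "z \<in> carrier B"
    then obtain x' y' z' where x: "x' \<in> carrier A" "x = h x'"
      and y: "y' \<in> carrier A" "y = h y'" and z: "z' \<in> carrier A" "z = h z'"
      unfolding carrier by blast
    show "x \<otimes>\<^bsub>B\<^esub> y \<otimes>\<^bsub>B\<^esub> z = x \<otimes>\<^bsub>B\<^esub> (y \<otimes>\<^bsub>B\<^esub> z)"
      using x y z by (simp add: ops A.m_assoc)
    show "x \<curlywedge>\<^bsub>B\<^esub> y \<curlywedge>\<^bsub>B\<^esub> z = x \<curlywedge>\<^bsub>B\<^esub> (y \<curlywedge>\<^bsub>B\<^esub> z)"
      using x y z by (simp add: ops A.meet_assoc)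
    show "x \<curlyvee>\<^bsub>B\<^esub> y \<curlyvee>\<^bsub>B\<^esub> z = x \<curlyvee>\<^bsub>B\<^esub> (y \<curlyvee>\<^bsub>B\<^esub> z)"
      using x y z by (simp add: ops A.join_assoc)
    show "x \<curlywedge>\<^bsub>B\<^esub> (y \<curlyvee>\<^bsub>B\<^esub> z) = x \<curlywedge>\<^bsub>B\<^esub> y \<curlyvee>\<^bsub>B\<^esub> x \<curlywedge>\<^bsub>B\<^esub> z"
      using x y z by (simp add: ops A.meet_join_distrib)
    show "x \<otimes>\<^bsub>B\<^esub> y \<preceq>\<^bsub>B\<^esub> z \<longleftrightarrow> y \<preceq>\<^bsub>B\<^esub> (x \<leadsto>\<^bsub>B\<^esub> z)"
      using x y z by (simp add: ops le A.residuation)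
  next
    fix x y
    assume "x \<in> carrier B" "y \<in> carrier B"
    then obtain x' y' where x: "x' \<in> carrier A" "x = h x'" and y: "y' \<in> carrier A" "y = h y'"
      unfolding carrier by blast
    show "x \<otimes>\<^bsub>B\<^esub> y \<in> carrier B" "x \<curlywedge>\<^bsub>B\<^esub> y \<in> carrier B" "x \<curlyvee>\<^bsub>B\<^esub> y \<in> carrier B"
      "(x \<leadsto>\<^bsub>B\<^esub> y) \<in> carrier B"
      using x y by (simp_all add: ops carrier)
    show "x \<otimes>\<^bsub>B\<^esub> y = y \<otimes>\<^bsub>B\<^esub> x" using x y by (simp add: ops A.m_comm)
    show "x \<curlywedge>\<^bsub>B\<^esub> y = y \<curlywedge>\<^bsub>B\<^esub> x" using x y by (simp add: ops A.meet_comm)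
    show "x \<curlyvee>\<^bsub>B\<^esub> y = y \<curlyvee>\<^bsub>B\<^esub> x" using x y by (simp add: ops A.join_comm)
    show "x \<curlywedge>\<^bsub>B\<^esub> (x \<curlyvee>\<^bsub>B\<^esub> y) = x" using x y by (simp add: ops A.meet_join_absorb)
    show "x \<curlyvee>\<^bsub>B\<^esub> x \<curlywedge>\<^bsub>B\<^esub> y = x" using x y by (simp add: ops A.join_meet_absorb)
    show "(x \<leadsto>\<^bsub>B\<^esub> \<sim>\<^bsub>B\<^esub>y) = (y \<leadsto>\<^bsub>B\<^esub> \<sim>\<^bsub>B\<^esub>x)" using x y by (simp add: ops A.contraposition)
    show "x \<preceq>\<^bsub>B\<^esub> y \<or> y \<preceq>\<^bsub>B\<^esub> x" using x y by (simp add: le A.linear)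
  next
    fix x
    assume "x \<in> carrier B"
    then obtain x' where x: "x' \<in> carrier A" "x = h x'" unfolding carrier by blast
    show "\<one>\<^bsub>B\<^esub> \<otimes>\<^bsub>B\<^esub> x = x" "x \<otimes>\<^bsub>B\<^esub> \<one>\<^bsub>B\<^esub> = x" "\<sim>\<^bsub>B\<^esub>x \<in> carrier B"
      using x by (simp_all add: ops carrier)
    show "x \<otimes>\<^bsub>B\<^esub> x = x" using x by (simp add: ops A.mult_idem)
    show "\<sim>\<^bsub>B\<^esub>(\<sim>\<^bsub>B\<^esub>x) = x" using x by (simp add: ops A.neg_neg)
  next
    show "\<one>\<^bsub>B\<^esub> \<in> carrier B" by (simp add: one carrier)
    show "\<sim>\<^bsub>B\<^esub>\<one>\<^bsub>B\<^esub> = \<one>\<^bsub>B\<^esub>" by (simp add: ops A.odd)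
  qed
qed

text \<open>The product of the abstract chain is the minimum for the following linear order.\<close>

definition absorbs :: "int \<Rightarrow> int \<Rightarrow> bool"
  where "absorbs i j \<longleftrightarrow> \<bar>j\<bar> < \<bar>i\<bar> \<or> \<bar>i\<bar> = \<bar>j\<bar> \<and> i \<le> j"

lemma absorbs_linear: "absorbs i j \<or> absorbs j i"
  by (auto simp: absorbs_def)

lemma absorbs_antisym: "absorbs i j \<Longrightarrow> absorbs j i \<Longrightarrow> i = j"
  by (auto simp: absorbs_def)

lemma absorbs_trans: "absorbs i j \<Longrightarrow> absorbs j l \<Longrightarrow> absorbs i l"
  by (auto simp: absorbs_def)

lemma abstract_chain_sel:
  "carrier (abstract_chain k) = {- int k..int k}"
  "i \<otimes>\<^bsub>abstract_chain k\<^esub> j = (if absorbs i j then i else j)"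
  "\<one>\<^bsub>abstract_chain k\<^esub> = 0"
  "i \<curlywedge>\<^bsub>abstract_chain k\<^esub> j = min i j"
  "i \<curlyvee>\<^bsub>abstract_chain k\<^esub> j = max i j"
  "(i \<leadsto>\<^bsub>abstract_chain k\<^esub> j) = (if i \<le> j then max (- i) j else min (- i) j)"
  "\<sim>\<^bsub>abstract_chain k\<^esub>i = - i"
  by (auto simp: abstract_chain_def absorbs_def)

text \<open>For i < j, \<open>absorbs i j\<close> amounts to j \<le> - i, and for j < i so does
  \<open>absorbs j i\<close>; this is how - i enters the right-hand side.\<close>

lemma abstract_chain_residuation:
  "(if absorbs i j then i else j) \<le> l \<longleftrightarrow> j \<le> (if i \<le> l then max (- i) l else min (- i) l)"
  by (auto simp: absorbs_def le_max_iff_disj)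

lemma alg_le_abstract_chain: "i \<preceq>\<^bsub>abstract_chain k\<^esub> j \<longleftrightarrow> i \<le> j"
  by (simp add: alg_le_def abstract_chain_sel min_def)

lemma odd_sugihara_chain_abstract_chain: "odd_sugihara_chain (abstract_chain k)"
proof unfold_locales
  fix x y z
  show "x \<otimes>\<^bsub>abstract_chain k\<^esub> y \<otimes>\<^bsub>abstract_chain k\<^esub> z =
      x \<otimes>\<^bsub>abstract_chain k\<^esub> (y \<otimes>\<^bsub>abstract_chain k\<^esub> z)"
    unfolding abstract_chain_sel
    using absorbs_linear absorbs_antisym absorbs_trans by (smt (verit))
  show "x \<otimes>\<^bsub>abstract_chain k\<^esub> y = y \<otimes>\<^bsub>abstract_chain k\<^esub> x"
    unfolding abstract_chain_sel using absorbs_linear absorbs_antisym by auto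
  show "x \<otimes>\<^bsub>abstract_chain k\<^esub> y \<preceq>\<^bsub>abstract_chain k\<^esub> z \<longleftrightarrow>
      y \<preceq>\<^bsub>abstract_chain k\<^esub> (x \<leadsto>\<^bsub>abstract_chain k\<^esub> z)"
    unfolding alg_le_abstract_chain unfolding abstract_chain_sel
    by (rule abstract_chain_residuation)
qed (auto simp only: abstract_chain_sel alg_le_abstract_chain
    max_min_distrib2 absorbs_def, auto simp: Units_def)

section \<open>Lexicographic comparison of initial segments\<close>

definition lex_lt :: "nat \<Rightarrow> (nat \<Rightarrow> 'a::linorder) \<Rightarrow> (nat \<Rightarrow> 'a) \<Rightarrow> bool"
  where "lex_lt m p q \<longleftrightarrow> (\<exists>j \<in> {1..m}. (\<forall>k \<in> {1..<j}. p k = q k) \<and> p j < q j)"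

lemma lex_lt_0 [simp]: "\<not> lex_lt 0 p q"
  by (simp add: lex_lt_def)

lemma lex_lt_Suc:
  "lex_lt (Suc m) p q \<longleftrightarrow> lex_lt m p q \<or> (\<forall>k \<in> {1..m}. p k = q k) \<and> p (Suc m) < q (Suc m)"
  by (auto simp: lex_lt_def atLeastAtMostSuc_conv atLeastLessThanSuc_atLeastAtMost)

lemma lex_lt_mono: "lex_lt m p q \<Longrightarrow> m \<le> k \<Longrightarrow> lex_lt k p q"
  by (force simp: lex_lt_def)

lemma lex_lt_minD:
  assumes "lex_lt (min k m) p q"
  shows "lex_lt k p q" and "lex_lt m p q"
  by (rule lex_lt_mono[OF assms], simp)+

lemma lex_lt_cong:
  assumes "\<And>k. k \<in> {1..m} \<Longrightarrow> p k = p' k" and "\<And>k. k \<in> {1..m} \<Longrightarrow> q k = q' k"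
  shows "lex_lt m p q \<longleftrightarrow> lex_lt m p' q'"
  unfolding lex_lt_def using assms by (intro bex_cong refl) auto

lemma lex_lt_irrefl [simp]: "\<not> lex_lt m p p"
  by (simp add: lex_lt_def)

lemma lex_lt_neither_iff: "\<not> lex_lt m p q \<and> \<not> lex_lt m q p \<longleftrightarrow> (\<forall>k \<in> {1..m}. p k = q k)"
  by (induction m) (auto simp: lex_lt_Suc atLeastAtMostSuc_conv)

lemma lex_lt_asym:
  assumes "lex_lt m p q"
  shows "\<not> lex_lt m q p"
proof
  assume "lex_lt m q p"
  then obtain l where l: "l \<in> {1..m}" "\<forall>k \<in> {1..<l}. q k = p k" "q l < p l"
    by (auto simp: lex_lt_def)
  obtain j where j: "j \<in> {1..m}" "\<forall>k \<in> {1..<j}. p k = q k" "p j < q j"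
    using assms by (auto simp: lex_lt_def)
  show False using j l by (cases j l rule: linorder_cases) auto
qed

text \<open>Contrapositive form of transitivity of the preorder \<open>\<not> lex_lt m q p\<close>.
  The laws mixing \<open>lex_lt\<close> with its negation are read off from it.\<close>

lemma lex_lt_cotrans: "lex_lt m p q \<Longrightarrow> lex_lt m p r \<or> lex_lt m r q"
proof (induction m)
  case (Suc m)
  show ?case
  proof (cases "lex_lt m p q")
    case False
    with Suc.prems have eq: "\<forall>k \<in> {1..m}. p k = q k" and less: "p (Suc m) < q (Suc m)"
      by (auto simp: lex_lt_Suc)
    \<comment> \<open>Since p and q agree on the first \<open>m\<close> coordinates, r compares with
      both alike. Only when all three agree does coordinate \<open>Suc m\<close> decide, where r
      lies above p or below q.\<close>
    have "lex_lt m r p \<longleftrightarrow> lex_lt m r q" using eq by (intro lex_lt_cong) auto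
    then consider "lex_lt m p r" | "lex_lt m r q" | "\<forall>k \<in> {1..m}. p k = r k"
      using lex_lt_neither_iff[of m p r] by blast
    then show ?thesis
      by cases (use eq less in \<open>auto simp: lex_lt_Suc not_less\<close>)
  qed (use Suc.IH in \<open>auto simp: lex_lt_Suc\<close>)
qed simp

text \<open>The intermediate point is q with the deciding coordinate moved to a value between p and
  q. Exposing it as an update at some \<open>j \<in> {1..m}\<close> allows callers to show that it
  stays in \<open>X n\<close>.\<close>

lemma lex_lt_between:
  fixes p q :: "nat \<Rightarrow> 'a::dense_linorder"
  assumes "lex_lt m p q"
  obtains j x where "j \<in> {1..m}" "lex_lt m p (q(j := x))" "lex_lt m (q(j := x)) q"
proof -
  obtain j where j: "j \<in> {1..m}" "\<forall>k \<in> {1..<j}. p k = q k" "p j < q j"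
    using assms by (auto simp: lex_lt_def)
  obtain x where "p j < x" "x < q j" using dense[OF j(3)] by blast
  with j have "lex_lt m p (q(j := x))" "lex_lt m (q(j := x)) q"
    unfolding lex_lt_def by (auto intro!: bexI[of _ j])
  then show thesis using that j(1) by blast
qed

lemma lex_lt_upd:
  assumes "j \<in> {1..m}"
  shows "lex_lt m p (p(j := x)) \<longleftrightarrow> p j < x" and "lex_lt m (p(j := x)) p \<longleftrightarrow> x < p j"
  using assms by (auto simp: lex_lt_def split: if_splits intro!: bexI[of _ j])

text \<open>Combined with \<open>lex_lt_upd\<close>, this permits a strict step for a longer segment
  that leaves the comparison on a shorter one unchanged.\<close>

lemma lex_lt_upd_beyond:
  assumes "m < j"
  shows "lex_lt m (p(j := x)) q \<longleftrightarrow> lex_lt m p q" and "lex_lt m p (q(j := x)) \<longleftrightarrow> lex_lt m p q"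
  using assms by (auto intro!: lex_lt_cong)

section \<open>Relations given by initial segments\<close>

definition seg_lt :: "nat \<Rightarrow> nat \<Rightarrow> point rel"
  where "seg_lt n m = {(x, y). x \<in> X n \<and> y \<in> X n \<and> lex_lt m (fst x) (fst y)}"

text \<open>The total preorder belonging to \<open>lex_lt m\<close>, written as a negated converse
  because \<open>rtilde\<close> and \<open>rminus\<close> produce it in that shape.\<close>

definition seg_le :: "nat \<Rightarrow> nat \<Rightarrow> point rel"
  where "seg_le n m = {(x, y). x \<in> X n \<and> y \<in> X n \<and> \<not> lex_lt m (fst y) (fst x)}"

lemma upd_in_Qn: "p \<in> Qn n \<Longrightarrow> j \<in> {1..n} \<Longrightarrow> p(j := x) \<in> Qn n"
  by (auto simp: Qn_def PiE_iff extensional_def)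

lemma upd_in_X: "(p, b) \<in> X n \<Longrightarrow> j \<in> {1..n} \<Longrightarrow> (p(j := x), b) \<in> X n"
  by (auto simp: X_def upd_in_Qn)

lemma L_Union_eq: "(\<Union>j \<in> {1..m}. L n j) = {(p, q). p \<in> Qn n \<and> q \<in> Qn n \<and> lex_lt m p q}"
  unfolding L_def lex_lt_def by blast

lemma U_Union_eq_seg_lt: "(\<Union>j \<in> {1..m}. U n j) = seg_lt n m"
proof -
  have "((p, b), (q, d)) \<in> (\<Union>j \<in> {1..m}. U n j) \<longleftrightarrow>
      b \<in> {-1, 1} \<and> d \<in> {-1, 1} \<and> (p, q) \<in> (\<Union>j \<in> {1..m}. L n j)" for p q b d
    unfolding U_def by blast
  then have "((p, b), (q, d)) \<in> (\<Union>j \<in> {1..m}. U n j) \<longleftrightarrow> ((p, b), (q, d)) \<in> seg_lt n m" for p q b d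
    unfolding L_Union_eq seg_lt_def X_def by simp blast
  then show ?thesis by (auto simp only: set_eq_iff split_paired_All)
qed

lemma leX_eq: "leX n = seg_lt n n \<union> Id_on (X n)"
  unfolding leX_def lex_less_def L_Union_eq seg_lt_def X_def by auto

section \<open>The two negations and self-duality\<close>

lemma in_rtilde_iff:
  "((p, b), (q, d)) \<in> rtilde n R \<longleftrightarrow> (p, b) \<in> X n \<and> (q, d) \<in> X n \<and> ((q, - d), (p, b)) \<notin> R"
  by (auto simp: rtilde_def rcompl_def \<alpha>_def X_def relcomp_unfold)

lemma in_rminus_iff:
  "((p, b), (q, d)) \<in> rminus n R \<longleftrightarrow> (p, b) \<in> X n \<and> (q, d) \<in> X n \<and> ((q, d), (p, - b)) \<notin> R"
  by (auto simp: rminus_def rcompl_def \<alpha>_def X_def relcomp_unfold)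

lemma flip_in_X_iff: "(p, - b) \<in> X n \<longleftrightarrow> (p, b) \<in> X n"
  by (auto simp: X_def)

text \<open>Segment relations ignore the signs, so composing with \<alpha> has no effect and only
  the complemented converse remains.\<close>

lemma rtilde_seg [simp]: "rtilde n (seg_lt n m) = seg_le n m" "rtilde n (seg_le n m) = seg_lt n m"
  by (auto simp: in_rtilde_iff seg_lt_def seg_le_def flip_in_X_iff)

lemma rminus_seg [simp]: "rminus n (seg_lt n m) = seg_le n m" "rminus n (seg_le n m) = seg_lt n m"
  by (auto simp: in_rminus_iff seg_lt_def seg_le_def flip_in_X_iff)

text \<open>Members of \<open>Qn n\<close> are \<open>undefined\<close> outside
  \<open>{1..n}\<close>, so agreement on the first n coordinates is equality.\<close>

lemma Qn_eq_or_lex_lt: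
  assumes "p \<in> Qn n" "q \<in> Qn n"
  shows "p = q \<or> lex_lt n p q \<or> lex_lt n q p"
  using assms lex_lt_neither_iff[of n p q] unfolding Qn_def by (metis PiE_ext)

text \<open>Over distinct tuples exactly one of p < q and q < p holds, so the complemented converse
  keeps the strict part. Over a single tuple it relates opposite signs, and \<alpha> turns these
  back into equal ones.\<close>

lemma leX_self_dual: "rtilde n (leX n) = leX n" "rminus n (leX n) = leX n"
proof -
  have in_leX: "((p, b), (q, d)) \<in> leX n \<longleftrightarrow>
      (p, b) \<in> X n \<and> (q, d) \<in> X n \<and> (lex_lt n p q \<or> p = q \<and> b = d)" for p q b d
    by (auto simp: leX_eq seg_lt_def)
  have flip: "lex_lt n q p \<or> q = p \<and> d = - b \<longleftrightarrow> \<not> (lex_lt n p q \<or> p = q \<and> b = d)"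
    if "(p, b) \<in> X n" "(q, d) \<in> X n" for p q b d
  proof (cases "p = q")
    case True
    with that show ?thesis by (auto simp: X_def)
  next
    case False
    then show ?thesis
      using that Qn_eq_or_lex_lt[of p n q] lex_lt_asym[of n] unfolding X_def by blast
  qed
  \<comment> \<open>The two negations put the flip on different endpoints; this equation brings both
    conditions into the form used in \<open>flip\<close>.\<close>
  have neg: "- d = b \<longleftrightarrow> d = - b" for b d :: int by auto
  have "((p, b), (q, d)) \<in> rtilde n (leX n) \<longleftrightarrow> ((p, b), (q, d)) \<in> leX n"
    "((p, b), (q, d)) \<in> rminus n (leX n) \<longleftrightarrow> ((p, b), (q, d)) \<in> leX n" for p b q d
    using flip[of p b q d]
    by (simp only: in_rtilde_iff in_rminus_iff in_leX flip_in_X_iff neg; satx)+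
  then show "rtilde n (leX n) = leX n" "rminus n (leX n) = leX n"
    by (simp_all add: set_eq_iff)
qed

section \<open>Compositions of the segment relations\<close>

lemma lex_lt_le_trans: "lex_lt m p q \<Longrightarrow> \<not> lex_lt m r q \<Longrightarrow> lex_lt m p r"
  using lex_lt_cotrans[of m p q r] by blast

lemma lex_le_lt_trans: "\<not> lex_lt m q p \<Longrightarrow> lex_lt m q r \<Longrightarrow> lex_lt m p r"
  using lex_lt_cotrans[of m q r p] by blast

text \<open>A strict inequality in the opposite direction on the shorter segment would persist on
  the longer one, against asymmetry.\<close>

lemma lex_lt_imp_le: "lex_lt k p q \<Longrightarrow> m \<le> k \<Longrightarrow> \<not> lex_lt m q p"
  using lex_lt_mono[of m q p k] lex_lt_asym[of k p q] by blast

lemma seg_lt_O_seg_lt: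
  assumes "k \<le> n" "m \<le> n"
  shows "seg_lt n k O seg_lt n m = seg_lt n (min k m)"
proof
  have "lex_lt (min k m) p q" if "lex_lt k p r" "lex_lt m r q" for p q r :: "nat \<Rightarrow> rat"
  proof (cases "k \<le> m")
    case True
    with that show ?thesis using lex_lt_le_trans[OF that(1) lex_lt_imp_le[OF that(2)]] by simp
  next
    case False
    with that show ?thesis using lex_le_lt_trans[OF lex_lt_imp_le[OF that(1)] that(2)] by simp
  qed
  then show "seg_lt n k O seg_lt n m \<subseteq> seg_lt n (min k m)"
    by (auto simp: seg_lt_def)
  show "seg_lt n (min k m) \<subseteq> seg_lt n k O seg_lt n m"
  proof clarify
    fix p b q d
    assume "((p, b), (q, d)) \<in> seg_lt n (min k m)"
    then have X: "(p, b) \<in> X n" "(q, d) \<in> X n" and lt: "lex_lt (min k m) p q"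
      by (auto simp: seg_lt_def)
    from lt obtain j x where j: "j \<in> {1..min k m}"
      and "lex_lt (min k m) p (q(j := x))" "lex_lt (min k m) (q(j := x)) q"
      by (rule lex_lt_between)
    \<comment> \<open>A midpoint for the shorter segment serves both factors, since
      \<open>lex_lt\<close> only grows with the segment.\<close>
    then have "lex_lt k p (q(j := x))" "lex_lt m (q(j := x)) q"
      by (blast dest: lex_lt_minD)+
    moreover have "(q(j := x), d) \<in> X n"
      using X j assms upd_in_X[of q d n j x] by simp
    ultimately show "((p, b), (q, d)) \<in> seg_lt n k O seg_lt n m"
      using X by (auto simp: seg_lt_def)
  qed
qed

lemma seg_le_O_seg_le:
  "seg_le n k O seg_le n m = seg_le n (min k m)"
proof
  have "\<not> lex_lt (min k m) q p" if "\<not> lex_lt k r p" "\<not> lex_lt m q r" for p q r :: "nat \<Rightarrow> rat"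
    using that lex_lt_cotrans[of "min k m" q p r] by (blast dest: lex_lt_minD)
  then show "seg_le n k O seg_le n m \<subseteq> seg_le n (min k m)"
    by (auto simp: seg_le_def)
  show "seg_le n (min k m) \<subseteq> seg_le n k O seg_le n m"
  proof
    fix z
    assume z: "z \<in> seg_le n (min k m)"
    \<comment> \<open>Reflexivity replaces density: the factor with the longer segment contributes a
      diagonal pair, and the other factor is z itself.\<close>
    have "(fst z, snd z) \<in> seg_le n k O seg_le n m"
    proof (cases "k \<le> m")
      case True
      then show ?thesis using z by (intro relcompI[of _ "snd z"]) (auto simp: seg_le_def)
    next
      case False
      then show ?thesis using z by (intro relcompI[of _ "fst z"]) (auto simp: seg_le_def)
    qed
    then show "z \<in> seg_le n k O seg_le n m" by simp
  qed
qed

text \<open>The shorter segment wins, and at equal length the strict factor wins. This tie rule is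
  the clause \<open>min i j\<close> of the abstract product for indices i and - i.\<close>

lemma seg_lt_O_seg_le:
  assumes "k \<le> n"
  shows "seg_lt n k O seg_le n m = (if k \<le> m then seg_lt n k else seg_le n m)"
proof (cases "k \<le> m")
  case True
  have "lex_lt k p q" if "lex_lt k p r" "\<not> lex_lt m q r" for p q r :: "nat \<Rightarrow> rat"
    using lex_lt_le_trans[OF that(1)] that(2) lex_lt_mono[OF _ True] by blast
  with True show ?thesis by (fastforce simp: seg_lt_def seg_le_def)
next
  case False
  have "\<not> lex_lt m q p" if "lex_lt k p r" "\<not> lex_lt m q r" for p q r :: "nat \<Rightarrow> rat"
    using that(2) lex_lt_imp_le[OF that(1), of m] lex_lt_cotrans[of m q p r] False by auto
  then have "seg_lt n k O seg_le n m \<subseteq> seg_le n m"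
    by (auto simp: seg_lt_def seg_le_def)
  moreover have "seg_le n m \<subseteq> seg_lt n k O seg_le n m"
  proof clarify
    fix p b q d
    assume "((p, b), (q, d)) \<in> seg_le n m"
    then show "((p, b), (q, d)) \<in> seg_lt n k O seg_le n m"
      using False assms upd_in_X[of p b n k "p k + 1"]
      \<comment> \<open>Raising coordinate k is a strict step for segment k, but as m < k the
        comparison on segment m does not see it.\<close>
      by (intro relcompI[of _ "(p(k := p k + 1), b)"])
        (auto simp: seg_lt_def seg_le_def lex_lt_upd lex_lt_upd_beyond)
  qed
  ultimately show ?thesis using False by auto
qed

lemma seg_le_O_seg_lt:
  assumes "k \<le> n"
  shows "seg_le n m O seg_lt n k = (if k \<le> m then seg_lt n k else seg_le n m)"
proof (cases "k \<le> m")
  case True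
  have "lex_lt k p q" if "\<not> lex_lt m r p" "lex_lt k r q" for p q r :: "nat \<Rightarrow> rat"
    using lex_le_lt_trans[OF _ that(2)] that(1) lex_lt_mono[OF _ True] by blast
  with True show ?thesis by (fastforce simp: seg_lt_def seg_le_def)
next
  case False
  have "\<not> lex_lt m q p" if "\<not> lex_lt m r p" "lex_lt k r q" for p q r :: "nat \<Rightarrow> rat"
    using that(1) lex_lt_imp_le[OF that(2), of m] lex_lt_cotrans[of m q p r] False by auto
  then have "seg_le n m O seg_lt n k \<subseteq> seg_le n m"
    by (auto simp: seg_lt_def seg_le_def)
  moreover have "seg_le n m \<subseteq> seg_le n m O seg_lt n k"
  proof clarify
    fix p b q d
    assume "((p, b), (q, d)) \<in> seg_le n m"
    then show "((p, b), (q, d)) \<in> seg_le n m O seg_lt n k"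
      using False assms upd_in_X[of q d n k "q k - 1"]
      \<comment> \<open>The strict factor now ends at q, so the intermediate point is q lowered in
        coordinate k.\<close>
      by (intro relcompI[of _ "(q(k := q k - 1), d)"])
        (auto simp: seg_lt_def seg_le_def lex_lt_upd lex_lt_upd_beyond)
  qed
  ultimately show ?thesis using False by auto
qed

lemma seg_subset_X: "seg_lt n m \<subseteq> X n \<times> X n" "seg_le n m \<subseteq> X n \<times> X n"
  by (auto simp: seg_lt_def seg_le_def)

text \<open>A sandwich: \<open>leX n\<close> lies between the identity on \<open>X n\<close> and
  \<open>seg_le n n\<close>, and both of these act as identities on the segment relations with
  \<open>m \<le> n\<close>.\<close>

lemma leX_O_seg:
  assumes "m \<le> n"
  shows "leX n O seg_lt n m = seg_lt n m" "seg_lt n m O leX n = seg_lt n m"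
    and "leX n O seg_le n m = seg_le n m" "seg_le n m O leX n = seg_le n m"
proof -
  have sub: "leX n \<subseteq> seg_le n n" and Id: "Id_on (X n) \<subseteq> leX n"
    by (auto simp: leX_eq seg_lt_def seg_le_def dest: lex_lt_asym)
  have *: "leX n O R = R" if "seg_le n n O R = R" "R \<subseteq> X n \<times> X n" for R
  proof
    show "leX n O R \<subseteq> R" using relcomp_mono[OF sub subset_refl] that(1) by blast
    show "R \<subseteq> leX n O R" using that(2) Id by blast
  qed
  have **: "R O leX n = R" if "R O seg_le n n = R" "R \<subseteq> X n \<times> X n" for R
  proof
    show "R O leX n \<subseteq> R" using relcomp_mono[OF subset_refl sub] that(1) by blast
    show "R \<subseteq> R O leX n" using that(2) Id by blast
  qed
  show "leX n O seg_lt n m = seg_lt n m" "seg_lt n m O leX n = seg_lt n m"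
    "leX n O seg_le n m = seg_le n m" "seg_le n m O leX n = seg_le n m"
    by (rule * **,
        simp add: assms seg_le_O_seg_lt seg_lt_O_seg_le seg_le_O_seg_le,
        rule seg_subset_X)+
qed

text \<open>The sandwich would only give the upper bound \<open>seg_le n n\<close>. Splitting the
  right factor into strict part and diagonal reduces the claim to \<open>leX_O_seg\<close>.\<close>

lemma leX_O_leX: "leX n O leX n = leX n"
proof -
  have Id: "leX n O Id_on (X n) = leX n" by (auto simp: leX_def)
  have "leX n O leX n = leX n O (seg_lt n n \<union> Id_on (X n))" by (simp only: leX_eq)
  also have "\<dots> = seg_lt n n \<union> leX n"
    by (simp only: relcomp_distrib Id leX_O_seg(1)[OF order_refl])
  also have "\<dots> = leX n" unfolding leX_eq by blast
  finally show ?thesis .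
qed

section \<open>The chain of relations\<close>

lemma Rel_0: "Rel n 0 = leX n"
  by (simp add: Rel_def Rel_nonpos_def)

text \<open>Indices - (n + 1), ..., - 1 become segment lengths 0, ..., n. At length 0 nothing is
  comparable, which matches the separate empty clause of \<open>Rel_nonpos\<close>.\<close>

lemma Rel_neg:
  assumes "- int n - 1 \<le> i" "i < 0"
  shows "Rel n i = seg_lt n (nat (int n + 1 + i))"
proof (cases "i = - int n - 1")
  case True
  then show ?thesis by (auto simp: Rel_def Rel_nonpos_def seg_lt_def)
next
  case False
  then show ?thesis
    using assms U_Union_eq_seg_lt by (simp add: Rel_def Rel_nonpos_def)
qed

lemma Rel_pos:
  assumes "0 < i" "i \<le> int n + 1"
  shows "Rel n i = seg_le n (nat (int n + 1 - i))"
proof -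
  have "Rel n i = rtilde n (Rel n (- i))" using assms by (simp add: Rel_def rtilde_def)
  then show ?thesis using assms by (simp add: Rel_neg)
qed

lemmas Rel_simps = Rel_0 Rel_neg Rel_pos

text \<open>Both negations are treated because \<open>rimp\<close> applies \<open>rminus\<close>
  inside and \<open>rtilde\<close> outside.\<close>

lemma Rel_neg_index:
  assumes "i \<in> {- (int n + 1)..int n + 1}"
  shows "Rel n (- i) = rtilde n (Rel n i)" and "Rel n (- i) = rminus n (Rel n i)"
proof -
  consider "i < 0" | "i = 0" | "0 < i" by linarith
  then have "Rel n (- i) = rtilde n (Rel n i) \<and> Rel n (- i) = rminus n (Rel n i)"
  proof cases
    case 1
    then show ?thesis using assms Rel_neg[of n i] Rel_pos[of "- i" n] by simp
  next
    case 2
    then show ?thesis by (simp add: Rel_0 leX_self_dual)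
  next
    case 3
    then show ?thesis using assms Rel_pos[of i n] Rel_neg[of n "- i"] by simp
  qed
  then show "Rel n (- i) = rtilde n (Rel n i)" "Rel n (- i) = rminus n (Rel n i)" by blast+
qed

text \<open>A nonzero index i has segment length n + 1 - |i|, so a larger absolute value means a
  coarser relation, and the coarser factor determines the composition.\<close>

lemma Rel_comp:
  assumes "i \<in> {- (int n + 1)..int n + 1}" "j \<in> {- (int n + 1)..int n + 1}"
  shows "Rel n i O Rel n j = Rel n (i \<otimes>\<^bsub>abstract_chain (n + 1)\<^esub> j)"
proof -
  consider "i = 0" | "j = 0" | "i < 0" "j < 0" | "i < 0" "0 < j" | "0 < i" "j < 0" | "0 < i" "0 < j"
    by linarith
  then show ?thesis
  proof cases
    case 1
    then show ?thesis using assms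
      by (cases j "0 :: int" rule: linorder_cases)
        (simp_all add: Rel_simps leX_O_seg leX_O_leX abstract_chain_def)
  next
    case 2
    then show ?thesis using assms
      by (cases i "0 :: int" rule: linorder_cases)
        (simp_all add: Rel_simps leX_O_seg leX_O_leX abstract_chain_def)
  qed (use assms in \<open>auto simp: Rel_simps seg_lt_O_seg_lt seg_lt_O_seg_le seg_le_O_seg_lt
      seg_le_O_seg_le abstract_chain_def min_def\<close>)
qed

section \<open>Strict monotonicity of the indexing\<close>

lemma Rel_mono:
  assumes "- (int n + 1) \<le> i" "i \<le> j" "j \<le> int n + 1"
  shows "Rel n i \<subseteq> Rel n j"
proof -
  have lt: "seg_lt n k \<subseteq> seg_lt n m" if "k \<le> m" for k m
    using that lex_lt_mono by (auto simp: seg_lt_def)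
  have le: "seg_le n m \<subseteq> seg_le n k" if "k \<le> m" for k m
    using that lex_lt_mono by (auto simp: seg_le_def)
  have sub: "seg_lt n n \<subseteq> leX n" "leX n \<subseteq> seg_le n n"
    by (auto simp: leX_eq seg_lt_def seg_le_def dest: lex_lt_asym)
  have mid: "seg_lt n k \<subseteq> leX n" "leX n \<subseteq> seg_le n k" if "k \<le> n" for k
    using that lt le sub by blast+
  consider "i < 0" "j < 0" | "i < 0" "j = 0" | "i < 0" "0 < j" | "i = 0" "j = 0"
    | "i = 0" "0 < j" | "0 < i" "0 < j"
    using assms by linarith
  then show ?thesis
  proof cases
    case 3
    then have "Rel n i \<subseteq> leX n" "leX n \<subseteq> Rel n j" using assms by (simp_all add: Rel_simps mid)
    then show ?thesis by blast
  qed (use assms in \<open>simp_all add: Rel_simps mid lt le\<close>)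
qed

text \<open>Each step has a separating pair: two points differing in one coordinate for steps
  between segment relations, a diagonal pair below index 0, and two opposite signs over one tuple
  above it.\<close>

lemma Rel_step:
  assumes "- (int n + 1) < i" "i \<le> int n + 1"
  shows "Rel n i \<noteq> Rel n (i - 1)"
proof -
  define o' :: "nat \<Rightarrow> rat" where "o' = (\<lambda>k \<in> {1..n}. 0)"
  have o': "(o', b) \<in> X n \<longleftrightarrow> b \<in> {-1, 1}" for b by (auto simp: o'_def X_def Qn_def)
  consider "i < 0" | "i = 0" | "i = 1" | "1 < i" by linarith
  then show ?thesis
  proof cases
    case 1
    \<comment> \<open>\<open>Suc m\<close> is the segment length of index i and \<open>m\<close>
      that of i - 1; the pair differs exactly in coordinate \<open>Suc m\<close>.\<close>
    define m where "m = nat (int n + i)"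
    have m: "Suc m \<le> n" "nat (int n + 1 + i) = Suc m" using 1 assms by (auto simp: m_def)
    let ?e = "o'(Suc m := o' (Suc m) + 1)"
    have "(?e, 1) \<in> X n" using m o' by (intro upd_in_X) auto
    then have "((o', 1), (?e, 1)) \<in> seg_lt n (Suc m) - seg_lt n m"
      using o' by (simp add: seg_lt_def lex_lt_upd lex_lt_upd_beyond)
    then show ?thesis using 1 assms m by (auto simp: Rel_neg m_def)
  next
    case 2
    have "((o', 1), (o', 1)) \<in> leX n - seg_lt n n"
      using o' by (simp add: leX_eq seg_lt_def Id_on_iff)
    then show ?thesis using 2 by (auto simp: Rel_simps)
  next
    case 3
    have "((o', 1), (o', - 1)) \<in> seg_le n n - leX n"
      using o' by (simp add: leX_eq seg_lt_def seg_le_def Id_on_iff)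
    then show ?thesis using 3 by (auto simp: Rel_simps)
  next
    case 4
    \<comment> \<open>For positive indices the lengths decrease: \<open>m\<close> belongs to i and
      \<open>Suc m\<close> to i - 1, so the separating pair is reversed.\<close>
    define m where "m = nat (int n + 1 - i)"
    have m: "Suc m \<le> n" "nat (int n + 1 - (i - 1)) = Suc m" using 4 assms by (auto simp: m_def)
    let ?e = "o'(Suc m := o' (Suc m) + 1)"
    have "(?e, 1) \<in> X n" using m o' by (intro upd_in_X) auto
    then have "((?e, 1), (o', 1)) \<in> seg_le n m - seg_le n (Suc m)"
      using o' by (simp add: seg_le_def lex_lt_upd lex_lt_upd_beyond)
    moreover have "Rel n i = seg_le n m" "Rel n (i - 1) = seg_le n (Suc m)"
      using 4 assms m by (simp_all add: Rel_pos m_def)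
    ultimately show ?thesis by auto
  qed
qed

lemma Rel_strict_mono:
  assumes "- (int n + 1) \<le> i" "i < j" "j \<le> int n + 1"
  shows "Rel n i \<subset> Rel n j"
proof -
  have "Rel n i \<subseteq> Rel n (j - 1)" "Rel n (j - 1) \<subseteq> Rel n j" "Rel n j \<noteq> Rel n (j - 1)"
    using assms Rel_mono[of n i "j - 1"] Rel_mono[of n "j - 1" j] Rel_step[of n j] by simp_all
  then show ?thesis by blast
qed

lemma inj_on_Rel: "inj_on (Rel n) {- (int n + 1)..int n + 1}"
proof (rule linorder_inj_onI')
  fix i j assume "i \<in> {- (int n + 1)..int n + 1}" "j \<in> {- (int n + 1)..int n + 1}" "i < j"
  then show "Rel n i \<noteq> Rel n j" using Rel_strict_mono[of n i j] by auto
qed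

section \<open>Implication and the isomorphism\<close>

lemma Rel_imp:
  assumes "i \<in> {- (int n + 1)..int n + 1}" "j \<in> {- (int n + 1)..int n + 1}"
  shows "rimp n (Rel n i) (Rel n j) = Rel n (i \<leadsto>\<^bsub>abstract_chain (n + 1)\<^esub> j)"
proof -
  \<comment> \<open>The definition of \<open>rimp\<close> read on indices: negate j, multiply by i,
    negate the result. The abstract implication is exactly \<open>- ?k\<close>.\<close>
  let ?k = "- j \<otimes>\<^bsub>abstract_chain (n + 1)\<^esub> i"
  have "?k \<in> {- (int n + 1)..int n + 1}" using assms by (auto simp: abstract_chain_def)
  moreover have "- ?k = (i \<leadsto>\<^bsub>abstract_chain (n + 1)\<^esub> j)"
    by (auto simp: abstract_chain_def min_def max_def)
  moreover have "rimp n (Rel n i) (Rel n j) = rtilde n (Rel n (- j) O Rel n i)"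
    using assms by (simp add: rimp_def Rel_neg_index(2))
  ultimately show ?thesis using assms by (simp add: Rel_comp flip: Rel_neg_index(1))
qed

lemma Rel_algebra_iso: "Rel n \<in> algebra_iso (abstract_chain (n + 1)) (relation_chain n)"
proof -
  let ?I = "{- (int n + 1)..int n + 1}"
  have carrier: "carrier (abstract_chain (n + 1)) = ?I" by (auto simp: abstract_chain_def)
  \<comment> \<open>The relations form a chain under inclusion, so intersection and union select the
    smaller and the larger of two.\<close>
  have lattice: "Rel n (min i j) = Rel n i \<inter> Rel n j \<and> Rel n (max i j) = Rel n i \<union> Rel n j"
    if "i \<in> ?I" "j \<in> ?I" for i j
    using that Rel_mono[of n i j] Rel_mono[of n j i] by (cases "i \<le> j") (auto simp: min_def max_def)
  have "Rel n \<in> iso (abstract_chain (n + 1)) (relation_chain n)"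
    using inj_on_Rel[of n] unfolding iso_def hom_def carrier bij_betw_def
    by (auto simp: relation_chain_def Rel_comp)
  moreover have "one (relation_chain n) = Rel n 0" "lneg (relation_chain n) = rtilde n"
    "lmeet (relation_chain n) = (\<inter>)" "ljoin (relation_chain n) = (\<union>)"
    "limp (relation_chain n) = rimp n"
    by (simp_all add: relation_chain_def)
  ultimately show ?thesis
    unfolding algebra_iso_def carrier
    using lattice Rel_imp[of _ n] Rel_neg_index(1)[of _ n]
    by (simp only: abstract_chain_sel(3-5,7) mem_Collect_eq) blast
qed

theorem theorem3p11:
  fixes n :: nat
  assumes "n \<ge> 1"
  shows "odd_sugihara_chain (relation_chain n) \<and>
    algebra_isomorphic (abstract_chain (n + 1)) (relation_chain n)"
  using Rel_algebra_iso algebra_iso_transfers_odd_sugihara_chain odd_sugihara_chain_abstract_chain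
  unfolding algebra_isomorphic_def by blast

end
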